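(* Let $d\ge 0$ be an integer, let $n_0,\dots,n_d$ and $m_1,\dots,m_d$ be non-negative integers, and let $V=\sum_{i=0}^{d} n_i\,\mathrm{Sym}^{2i}(\mathbb{C}^2)$ and $W=\sum_{i=1}^{d} m_i\,\mathrm{Sym}^{2i-1}(\mathbb{C}^2)$ be two finite dimensional representations of $\mathrm{SU}(2)$. Then $$2\dim\big((V\otimes W)[1]\big)-\dim\big((V\otimes V)[2]\oplus (W\otimes W)[2]\big)\;\leq\;\sum_{i=0}^{d} n_i^2+\sum_{i=1}^{d} m_i^2 .$$
   Context: $\mathrm{Sym}^{k}(\mathbb{C}^2)$ is the $(k+1)$-dimensional irreducible representation of $\mathrm{SU}(2)$, and $\sum_i n_i\,\mathrm{Sym}^{k_i}(\mathbb{C}^2)$ denotes the direct sum in which $\mathrm{Sym}^{k_i}(\mathbb{C}^2)$ occurs with multiplicity $n_i$. For a finite dimensional representation $E$ of $\mathrm{SU}(2)$ and an integer $i$, $E[i]$ denotes the subspace of $E$ on which the standard maximal torus $\mathbb{S}^1=\{\mathrm{diag}(z,z^{-1}) : |z|=1\}$ operates by the character $z\mapsto z^i$. *)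

theory Defs
  imports "Jordan_Normal_Form.Schur_Decomposition"
begin

definition SU2 :: "complex mat set" where
  "SU2 = {g \<in> carrier_mat 2 2. g * mat_adjoint g = 1\<^sub>m 2 \<and> det g = 1}"

definition torus :: "complex \<Rightarrow> complex mat" where
  "torus z = mat 2 2 (\<lambda>(i, j). if i \<noteq> j then 0 else if i = 0 then z else inverse z)"

text \<open>
  A finite-dimensional representation is given in coordinates: the underlying space is
  \<^term>\<open>carrier_vec n\<close> over the complex numbers with \<open>n = rdim E\<close>, and a group element \<open>g\<close>
  operates by the matrix \<open>act E g\<close>. Only the values of \<open>act E\<close> on \<open>SU2\<close> are meaningful.
\<close>

record rep =
  rdim :: nat
  act :: "complex mat \<Rightarrow> complex mat"

definition is_SU2_rep :: "rep \<Rightarrow> bool" where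
  "is_SU2_rep E \<longleftrightarrow>
     (\<forall>g\<in>SU2. act E g \<in> carrier_mat (rdim E) (rdim E)) \<and>
     act E (1\<^sub>m 2) = 1\<^sub>m (rdim E) \<and>
     (\<forall>g\<in>SU2. \<forall>h\<in>SU2. act E (g * h) = act E g * act E h)"

text \<open>
  The symmetric power is the space of homogeneous polynomials of degree \<open>k\<close> in the standard basis
  \<open>x, y\<close> of the complex plane, with basis \<open>x^(k-s) y^s\<close> for \<open>s \<le> k\<close>. The matrix \<open>g\<close> sends \<open>x\<close> and
  \<open>y\<close> to its columns \<open>a x + c y\<close> and \<open>b x + d y\<close>, so column \<open>s\<close> of the action holds the
  coefficients of \<open>(a x + c y)^(k-s) (b x + d y)^s\<close>. These are read off after setting \<open>x = 1\<close>;
  the polynomial variable is \<open>y\<close>.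
\<close>

definition sym_rep :: "nat \<Rightarrow> rep" where
  "sym_rep k = \<lparr> rdim = k + 1,
     act = (\<lambda>g. mat (k + 1) (k + 1) (\<lambda>(r, s).
       coeff ([:g $$ (0, 0), g $$ (1, 0):] ^ (k - s) * [:g $$ (0, 1), g $$ (1, 1):] ^ s) r)) \<rparr>"

definition sum_rep :: "rep list \<Rightarrow> rep" where
  "sum_rep Es = \<lparr> rdim = sum_list (map rdim Es),
     act = (\<lambda>g. diag_block_mat (map (\<lambda>E. act E g) Es)) \<rparr>"

text \<open>
  Kronecker product of matrices: the basis vector \<open>e_i \<otimes> f_j\<close> of the tensor product has the
  index \<open>i * rdim F + j\<close>.
\<close>

definition tensor_rep :: "rep \<Rightarrow> rep \<Rightarrow> rep" where
  "tensor_rep E F = \<lparr> rdim = rdim E * rdim F,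
     act = (\<lambda>g. mat (rdim E * rdim F) (rdim E * rdim F) (\<lambda>(r, s).
       act E g $$ (r div rdim F, s div rdim F) * act F g $$ (r mod rdim F, s mod rdim F))) \<rparr>"

lemma one_in_SU2: "1\<^sub>m 2 \<in> SU2"
  unfolding SU2_def
  by (auto intro!: eq_matI simp: mat_adjoint_def mat_of_rows_def scalar_prod_def
      numeral_2_eq_2 less_Suc_eq)

lemma torus_in_SU2:
  assumes "cmod z = 1"
  shows "torus z \<in> SU2"
proof -
  have "z \<noteq> 0" "z * cnj z = 1"
    using assms by (auto simp: complex_norm_square[symmetric])
  moreover from this have "inverse z * cnj (inverse z) = 1"
    by (simp add: field_simps)
  moreover have "det (torus z) = z * inverse z"
    by (subst det_upper_triangular[of _ 2]) (auto simp: torus_def diag_mat_def numeral_2_eq_2)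
  ultimately show ?thesis
    unfolding SU2_def
    by (auto intro!: eq_matI simp: torus_def mat_adjoint_def mat_of_rows_def scalar_prod_def
        numeral_2_eq_2 less_Suc_eq)
qed

lemma sym_rep_homogenize:
  fixes a b c d u v :: complex and P Q :: "complex poly"
  shows "degree ([:a, c:] ^ p * [:b, d:] ^ q) \<le> p + q \<and>
    (\<Sum>l\<le>p + q. smult (coeff ([:a, c:] ^ p * [:b, d:] ^ q) l) (P ^ (p + q - l) * Q ^ l)) =
    (smult a P + smult c Q) ^ p * (smult b P + smult d Q) ^ q"
proof -
  define H where "H k f = (\<Sum>l\<le>k. smult (coeff f l) (P ^ (k - l) * Q ^ l))"
    for k :: nat and f :: "complex poly"
  have step: "degree ([:u, v:] * f) \<le> Suc k \<and>
      H (Suc k) ([:u, v:] * f) = (smult u P + smult v Q) * H k f"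
    if f: "degree f \<le> k" for u v f k
  proof
    show "degree ([:u, v:] * f) \<le> Suc k"
      using degree_mult_le[of "[:u, v:]" f] f by (simp split: if_splits)
    have c0: "coeff f (Suc k) = 0" using f by (simp add: coeff_eq_0)
    have "H (Suc k) ([:u, v:] * f) =
        (\<Sum>l\<le>Suc k. smult (u * coeff f l) (P ^ (Suc k - l) * Q ^ l)) +
        (\<Sum>l\<le>Suc k. smult (coeff (pCons 0 (smult v f)) l) (P ^ (Suc k - l) * Q ^ l))"
      unfolding H_def by (simp add: smult_add_left sum.distrib del: sum.atMost_Suc)
    also have "(\<Sum>l\<le>Suc k. smult (u * coeff f l) (P ^ (Suc k - l) * Q ^ l)) = smult u P * H k f"
      unfolding H_def sum_distrib_left
      by (auto simp: c0 Suc_diff_le algebra_simps intro!: sum.cong)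
    also have "(\<Sum>l\<le>Suc k. smult (coeff (pCons 0 (smult v f)) l) (P ^ (Suc k - l) * Q ^ l)) =
        smult v Q * H k f"
      unfolding H_def sum_distrib_left
      by (subst sum.atMost_Suc_shift) (auto simp: algebra_simps intro!: sum.cong)
    finally show "H (Suc k) ([:u, v:] * f) = (smult u P + smult v Q) * H k f"
      by (simp add: algebra_simps)
  qed
  have q: "degree ([:b, d:] ^ q) \<le> q \<and> H q ([:b, d:] ^ q) = (smult b P + smult d Q) ^ q" for q
  proof (induction q)
    case 0
    show ?case by (simp add: H_def)
  next
    case (Suc q)
    then show ?case using step[of "[:b, d:] ^ q" q b d] by simp
  qed
  have "degree ([:a, c:] ^ p * [:b, d:] ^ q) \<le> p + q \<and>
      H (p + q) ([:a, c:] ^ p * [:b, d:] ^ q) =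
      (smult a P + smult c Q) ^ p * (smult b P + smult d Q) ^ q"
  proof (induction p)
    case 0
    show ?case using q by simp
  next
    case (Suc p)
    then show ?case
      using step[of "[:a, c:] ^ p * [:b, d:] ^ q" "p + q" a c]
      by (simp add: mult.assoc del: mult_pCons_left)
  qed
  then show ?thesis unfolding H_def .
qed

lemma is_SU2_rep_sym_rep: "is_SU2_rep (sym_rep k)"
  unfolding is_SU2_rep_def
proof (intro conjI ballI)
  show "act (sym_rep k) g \<in> carrier_mat (rdim (sym_rep k)) (rdim (sym_rep k))" for g
    by (simp add: sym_rep_def)
  show "act (sym_rep k) (1\<^sub>m 2) = 1\<^sub>m (rdim (sym_rep k))"
  proof (rule eq_matI)
    fix r s
    assume "r < dim_row (1\<^sub>m (rdim (sym_rep k)))" "s < dim_col (1\<^sub>m (rdim (sym_rep k)))"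
    moreover have "[:0, 1::complex:] ^ s = monom 1 s"
      by (simp add: monom_altdef)
    ultimately show "act (sym_rep k) (1\<^sub>m 2) $$ (r, s) = 1\<^sub>m (rdim (sym_rep k)) $$ (r, s)"
      by (simp add: sym_rep_def one_pCons[symmetric])
  qed (simp_all add: sym_rep_def)
next
  fix g h
  assume "g \<in> SU2" "h \<in> SU2"
  then have gh: "g \<in> carrier_mat 2 2" "h \<in> carrier_mat 2 2" by (auto simp: SU2_def)
  define P where "P = [:g $$ (0, 0), g $$ (1, 0):]"
  define Q where "Q = [:g $$ (0, 1), g $$ (1, 1):]"
  have cols: "[:(g * h) $$ (0, j), (g * h) $$ (1, j):] =
      smult (h $$ (0, j)) P + smult (h $$ (1, j)) Q" if "j < 2" for j
    using gh that by (simp add: P_def Q_def scalar_prod_def numeral_2_eq_2 algebra_simps)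
  show "act (sym_rep k) (g * h) = act (sym_rep k) g * act (sym_rep k) h"
  proof (rule eq_matI)
    fix r s
    assume "r < dim_row (act (sym_rep k) g * act (sym_rep k) h)"
      "s < dim_col (act (sym_rep k) g * act (sym_rep k) h)"
    then have rs: "r < k + 1" "s < k + 1" by (auto simp: sym_rep_def)
    define f where "f = [:h $$ (0, 0), h $$ (1, 0):] ^ (k - s) * [:h $$ (0, 1), h $$ (1, 1):] ^ s"
    have "act (sym_rep k) (g * h) $$ (r, s) =
        coeff ((smult (h $$ (0, 0)) P + smult (h $$ (1, 0)) Q) ^ (k - s) *
          (smult (h $$ (0, 1)) P + smult (h $$ (1, 1)) Q) ^ s) r"
      using rs by (simp add: sym_rep_def cols del: One_nat_def)
    also have "\<dots> = coeff (\<Sum>l\<le>k. smult (coeff f l) (P ^ (k - l) * Q ^ l)) r"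
      using sym_rep_homogenize[of "h $$ (0, 0)" "h $$ (1, 0)" "k - s" "h $$ (0, 1)" "h $$ (1, 1)" s P Q] rs
      by (simp add: f_def)
    also have "\<dots> = (\<Sum>l<k + 1. coeff (P ^ (k - l) * Q ^ l) r * coeff f l)"
      by (simp add: coeff_sum lessThan_Suc_atMost mult.commute)
    also have "\<dots> = (act (sym_rep k) g * act (sym_rep k) h) $$ (r, s)"
      using rs by (simp add: sym_rep_def scalar_prod_def f_def P_def Q_def atLeast0LessThan
          del: sum.lessThan_Suc sum.op_ivl_Suc)
    finally show "act (sym_rep k) (g * h) $$ (r, s) =
        (act (sym_rep k) g * act (sym_rep k) h) $$ (r, s)" .
  qed (simp_all add: sym_rep_def)
qed

lemma sum_mult_div_mod:
  fixes f :: "nat \<Rightarrow> nat \<Rightarrow> complex"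
  assumes "n > 0"
  shows "(\<Sum>l<m * n. f (l div n) (l mod n)) = (\<Sum>i<m. \<Sum>j<n. f i j)"
proof -
  have "(\<Sum>l<m * n. f (l div n) (l mod n)) =
      (\<Sum>i<m. \<Sum>l\<in>{i * n..<i * n + n}. f (l div n) (l mod n))"
    by (rule sum.nat_group[symmetric])
  also have "\<dots> = (\<Sum>i<m. \<Sum>j<n. f i j)"
  proof (rule sum.cong[OF refl])
    fix i
    have "(\<Sum>l\<in>{i * n..<i * n + n}. f (l div n) (l mod n)) =
        (\<Sum>j<n. f ((j + i * n) div n) ((j + i * n) mod n))"
      using sum.shift_bounds_nat_ivl[of "\<lambda>l. f (l div n) (l mod n)" 0 "i * n" n]
      by (simp add: atLeast0LessThan add.commute)
    also have "\<dots> = (\<Sum>j<n. f i j)"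
      by (rule sum.cong) auto
    finally show "(\<Sum>l\<in>{i * n..<i * n + n}. f (l div n) (l mod n)) = (\<Sum>j<n. f i j)" .
  qed
  finally show ?thesis .
qed

lemma is_SU2_rep_tensor_rep:
  assumes E: "is_SU2_rep E" and F: "is_SU2_rep F"
  shows "is_SU2_rep (tensor_rep E F)"
  unfolding is_SU2_rep_def
proof (intro conjI ballI)
  let ?m = "rdim E" and ?n = "rdim F"
  have bounds: "r div ?n < ?m" "r mod ?n < ?n" "?n > 0" if "r < ?m * ?n" for r
    using that by (auto simp: less_mult_imp_div_less intro!: mod_less_divisor gr0I)
  show "act (tensor_rep E F) g \<in> carrier_mat (rdim (tensor_rep E F)) (rdim (tensor_rep E F))" for g
    by (simp add: tensor_rep_def)
  show "act (tensor_rep E F) (1\<^sub>m 2) = 1\<^sub>m (rdim (tensor_rep E F))"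
  proof (rule eq_matI)
    fix r s
    assume "r < dim_row (1\<^sub>m (rdim (tensor_rep E F)))" "s < dim_col (1\<^sub>m (rdim (tensor_rep E F)))"
    then have rs: "r < ?m * ?n" "s < ?m * ?n" by (auto simp: tensor_rep_def)
    have "r = s \<longleftrightarrow> r div ?n = s div ?n \<and> r mod ?n = s mod ?n"
      by (metis div_mult_mod_eq)
    then show "act (tensor_rep E F) (1\<^sub>m 2) $$ (r, s) = 1\<^sub>m (rdim (tensor_rep E F)) $$ (r, s)"
      using rs bounds[of r] bounds[of s] E F
      by (auto simp: tensor_rep_def is_SU2_rep_def)
  qed (simp_all add: tensor_rep_def)
  fix g h
  assume gh: "g \<in> SU2" "h \<in> SU2"
  then have car: "act E g \<in> carrier_mat ?m ?m" "act E h \<in> carrier_mat ?m ?m"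
      "act F g \<in> carrier_mat ?n ?n" "act F h \<in> carrier_mat ?n ?n"
    and mul: "act E (g * h) = act E g * act E h" "act F (g * h) = act F g * act F h"
    using E F by (auto simp: is_SU2_rep_def)
  show "act (tensor_rep E F) (g * h) = act (tensor_rep E F) g * act (tensor_rep E F) h"
  proof (rule eq_matI)
    fix r s
    assume "r < dim_row (act (tensor_rep E F) g * act (tensor_rep E F) h)"
      "s < dim_col (act (tensor_rep E F) g * act (tensor_rep E F) h)"
    then have rs: "r < ?m * ?n" "s < ?m * ?n" by (auto simp: tensor_rep_def)
    note b = bounds[OF rs(1)] bounds[OF rs(2)]
    have "(act (tensor_rep E F) g * act (tensor_rep E F) h) $$ (r, s) =
        (\<Sum>l<?m * ?n. act E g $$ (r div ?n, l div ?n) * act F g $$ (r mod ?n, l mod ?n) *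
          (act E h $$ (l div ?n, s div ?n) * act F h $$ (l mod ?n, s mod ?n)))"
      using rs by (simp add: tensor_rep_def scalar_prod_def atLeast0LessThan)
    also have "\<dots> = (\<Sum>i<?m. \<Sum>j<?n. act E g $$ (r div ?n, i) * act F g $$ (r mod ?n, j) *
          (act E h $$ (i, s div ?n) * act F h $$ (j, s mod ?n)))"
      using b(3) by (rule sum_mult_div_mod)
    also have "\<dots> = (\<Sum>i<?m. act E g $$ (r div ?n, i) * act E h $$ (i, s div ?n)) *
        (\<Sum>j<?n. act F g $$ (r mod ?n, j) * act F h $$ (j, s mod ?n))"
      by (simp add: sum_product mult_ac)
    also have "\<dots> = act (tensor_rep E F) (g * h) $$ (r, s)"
      using rs b car by (simp add: tensor_rep_def mul scalar_prod_def atLeast0LessThan)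
    finally show "act (tensor_rep E F) (g * h) $$ (r, s) =
        (act (tensor_rep E F) g * act (tensor_rep E F) h) $$ (r, s)" ..
  qed (simp_all add: tensor_rep_def)
qed

lemma is_SU2_rep_sum_rep:
  assumes "\<forall>E\<in>set Es. is_SU2_rep E"
  shows "is_SU2_rep (sum_rep Es)"
  using assms
proof (induction Es)
  case Nil
  show ?case by (auto simp: is_SU2_rep_def sum_rep_def)
next
  case (Cons E Es)
  let ?m = "rdim E" and ?n = "rdim (sum_rep Es)"
  have E: "is_SU2_rep E" and F: "is_SU2_rep (sum_rep Es)" using Cons by auto
  have dim: "rdim (sum_rep (E # Es)) = ?m + ?n"
    by (simp add: sum_rep_def)
  have block: "act (sum_rep (E # Es)) g =
      four_block_mat (act E g) (0\<^sub>m ?m ?n) (0\<^sub>m ?n ?m) (act (sum_rep Es) g)"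
    if "act E g \<in> carrier_mat ?m ?m" "act (sum_rep Es) g \<in> carrier_mat ?n ?n" for g
    using that by (simp add: sum_rep_def Let_def)
  show ?case
    unfolding is_SU2_rep_def
  proof (intro conjI ballI)
    fix g
    assume "g \<in> SU2"
    then have g: "act E g \<in> carrier_mat ?m ?m" "act (sum_rep Es) g \<in> carrier_mat ?n ?n"
      using E F by (auto simp: is_SU2_rep_def)
    then show "act (sum_rep (E # Es)) g
        \<in> carrier_mat (rdim (sum_rep (E # Es))) (rdim (sum_rep (E # Es)))"
      by (simp add: dim block)
    fix h
    assume "h \<in> SU2"
    then have h: "act E h \<in> carrier_mat ?m ?m" "act (sum_rep Es) h \<in> carrier_mat ?n ?n"
      using E F by (auto simp: is_SU2_rep_def)
    have mul: "act E (g * h) = act E g * act E h"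
        "act (sum_rep Es) (g * h) = act (sum_rep Es) g * act (sum_rep Es) h"
      using E F \<open>g \<in> SU2\<close> \<open>h \<in> SU2\<close> by (auto simp: is_SU2_rep_def)
    show "act (sum_rep (E # Es)) (g * h) = act (sum_rep (E # Es)) g * act (sum_rep (E # Es)) h"
      using g h mul
      by (simp add: block mult_four_block_mat[of _ ?m ?m _ ?n _ ?n _ _ ?m _ ?n])
  next
    have "act E (1\<^sub>m 2) = 1\<^sub>m ?m" "act (sum_rep Es) (1\<^sub>m 2) = 1\<^sub>m ?n"
      using E F by (auto simp: is_SU2_rep_def)
    then show "act (sum_rep (E # Es)) (1\<^sub>m 2) = 1\<^sub>m (rdim (sum_rep (E # Es)))"
      by (simp add: dim block)
  qed
qed

definition weight_space :: "rep \<Rightarrow> int \<Rightarrow> (complex, complex vec) module" where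
  "weight_space E i = (module_vec TYPE(complex) (rdim E))
     \<lparr> carrier := {v \<in> carrier_vec (rdim E).
         \<forall>z. cmod z = 1 \<longrightarrow> act E (torus z) *\<^sub>v v = (z powi i) \<cdot>\<^sub>v v} \<rparr>"

abbreviation cdim :: "(complex, 'v) module \<Rightarrow> nat" where
  "cdim \<equiv> vectorspace.dim class_ring"

end

theory Submission
  imports Defs
begin

text \<open>
  Counting pairs of weights, \<open>Sym^k \<otimes> Sym^l\<close> has \<open>min k l + 1\<close> as the dimension of its weight space
  1 if \<open>k + l\<close> is odd, and of its weight space 2 if \<open>k + l\<close> is even, except that in the latter case
  one has to subtract 1 if \<open>k = l\<close>. These exceptions add up to the right-hand side of the
  inequality, which therefore says that the quadratic form with matrix \<open>min k l + 1\<close> is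
  non-negative on the multiplicities, taken with sign \<open>(-1)^k\<close>. Since \<open>min k l + 1\<close> counts the
  \<open>j\<close> with \<open>j \<le> k\<close> and \<open>j \<le> l\<close>, this form is a sum of squares, one for each \<open>j\<close>.
\<close>

section \<open>Dimensions via coordinates\<close>

text \<open>An explicit linear isomorphism from C^k serves as witness of the dimension: no basis has
  to be exhibited, and such witnesses combine under direct sums.\<close>

definition coord_space :: "nat \<Rightarrow> (complex, 'v) module \<Rightarrow> bool" where
  "coord_space k M \<longleftrightarrow> (\<exists>T. linear_map class_ring (module_vec TYPE(complex) k) M T \<and>
     bij_betw T (carrier_vec k) (carrier M))"

lemma cdim_coord_space:
  assumes "coord_space k M"
  shows "cdim M = k"
proof -
  obtain T where T: "linear_map class_ring (module_vec TYPE(complex) k) M T"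
      "bij_betw T (carrier_vec k) (carrier M)"
    using assms by (auto simp: coord_space_def)
  interpret vec_space "TYPE(complex)" k .
  have "vectorspace.dim class_ring (module_vec TYPE(complex) k) = cdim M"
    using T by (intro linear_map.dim_eq[OF T(1)])
      (auto simp: bij_betw_def module_vec_simps)
  then show ?thesis using dim_is_n by simp
qed

lemma coord_spaceI:
  fixes M :: "(complex, 'v) module"
  assumes "vectorspace class_ring M"
    and "\<And>u. u \<in> carrier_vec k \<Longrightarrow> T u \<in> carrier M"
    and "\<And>u v. u \<in> carrier_vec k \<Longrightarrow> v \<in> carrier_vec k \<Longrightarrow> T (u + v) = T u \<oplus>\<^bsub>M\<^esub> T v"
    and "\<And>c u. u \<in> carrier_vec k \<Longrightarrow> T (c \<cdot>\<^sub>v u) = c \<odot>\<^bsub>M\<^esub> T u"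
    and "bij_betw T (carrier_vec k) (carrier M)"
  shows "coord_space k M"
  unfolding coord_space_def
proof (intro exI conjI)
  show "linear_map class_ring (module_vec TYPE(complex) k) M T"
    using assms(1-4) vec_vs[of k, where 'a = complex]
    by (auto simp: linear_map_def mod_hom_def mod_hom_axioms_def LinearCombinations.module_hom_def
        vectorspace_def module_vec_simps)
qed fact

text \<open>Cutting a vector of length \<open>k + l\<close> after its first \<open>k\<close> entries
  identifies C^(k+l) with C^k x C^l, where the two given isomorphisms apply componentwise.\<close>

lemma coord_space_direct_sum:
  assumes "coord_space k M" "coord_space l N"
  shows "coord_space (k + l) (direct_sum M N)"
proof -
  obtain S where S: "linear_map class_ring (module_vec TYPE(complex) k) M S"
      "bij_betw S (carrier_vec k) (carrier M)"
    using assms by (auto simp: coord_space_def)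
  obtain T where T: "linear_map class_ring (module_vec TYPE(complex) l) N T"
      "bij_betw T (carrier_vec l) (carrier N)"
    using assms by (auto simp: coord_space_def)
  interpret S: linear_map class_ring "module_vec TYPE(complex) k" M S by fact
  interpret T: linear_map class_ring "module_vec TYPE(complex) l" N T by fact
  define U where "U v = (S (vec_first v k), T (vec_last v l))" for v
  have add: "vec_first (u + v) k = vec_first u k + vec_first v k"
      "vec_last (u + v) l = vec_last u l + vec_last v l"
    if "u \<in> carrier_vec (k + l)" "v \<in> carrier_vec (k + l)" for u v :: "complex vec"
    using that by (auto simp: vec_first_def vec_last_def intro!: eq_vecI)
  have smult: "vec_first (c \<cdot>\<^sub>v u) k = c \<cdot>\<^sub>v vec_first u k"
      "vec_last (c \<cdot>\<^sub>v u) l = c \<cdot>\<^sub>v vec_last u l"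
    if "u \<in> carrier_vec (k + l)" for c and u :: "complex vec"
    using that by (auto simp: vec_first_def vec_last_def intro!: eq_vecI)
  show ?thesis
  proof (rule coord_spaceI[where T = U])
    show "vectorspace class_ring (direct_sum M N)"
      by (rule direct_sum_is_vs) unfold_locales
    show "U u \<in> carrier (direct_sum M N)" for u
      using S.T_im[of "vec_first u k"] T.T_im[of "vec_last u l"]
      by (simp add: U_def direct_sum_def module_vec_simps)
    show "U (u + v) = U u \<oplus>\<^bsub>direct_sum M N\<^esub> U v"
      if "u \<in> carrier_vec (k + l)" "v \<in> carrier_vec (k + l)" for u v
      using S.T_add[of "vec_first u k" "vec_first v k"] T.T_add[of "vec_last u l" "vec_last v l"] that
      by (simp add: U_def direct_sum_def module_vec_simps add)
    show "U (c \<cdot>\<^sub>v u) = c \<odot>\<^bsub>direct_sum M N\<^esub> U u" if "u \<in> carrier_vec (k + l)" for c u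
      using S.T_smult[of c "vec_first u k"] T.T_smult[of c "vec_last u l"] that
      by (simp add: U_def direct_sum_def module_vec_simps smult)
    have "bij_betw (\<lambda>v. (vec_first v k, vec_last v l)) (carrier_vec (k + l) :: complex vec set)
        (carrier_vec k \<times> carrier_vec l)"
    proof (rule bij_betw_byWitness[where f' = "\<lambda>(u, v). u @\<^sub>v v"])
      show "\<forall>x\<in>carrier_vec k \<times> carrier_vec l.
          (\<lambda>v. (vec_first v k, vec_last v l)) ((\<lambda>(u, v). u @\<^sub>v v) x) = (x :: complex vec \<times> _)"
        by (auto simp: vec_first_def vec_last_def append_vec_def Let_def intro!: eq_vecI)
    qed auto
    moreover have "bij_betw (map_prod S T) (carrier_vec k \<times> carrier_vec l)
        (carrier (direct_sum M N))"
      using S(2) T(2) unfolding bij_betw_def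
      by (auto simp: direct_sum_def intro!: map_prod_inj_on map_prod_surj_on)
    ultimately have "bij_betw (map_prod S T \<circ> (\<lambda>v. (vec_first v k, vec_last v l)))
        (carrier_vec (k + l)) (carrier (direct_sum M N))"
      by (rule bij_betw_trans)
    then show "bij_betw U (carrier_vec (k + l)) (carrier (direct_sum M N))"
      by (simp add: U_def[abs_def] comp_def)
  qed
qed

text \<open>Along an enumeration of \<open>S\<close>, a vector of length \<open>card S\<close> is
  spread over the positions in \<open>S\<close> and padded with zeros; the inverse map reads off the
  entries at these positions.\<close>

lemma coord_space_vanishing:
  fixes n :: nat and S :: "nat set"
  assumes "S \<subseteq> {..<n}"
  shows "coord_space (card S) ((module_vec TYPE(complex) n)
    \<lparr>carrier := {v \<in> carrier_vec n. \<forall>r<n. r \<notin> S \<longrightarrow> v $ r = 0}\<rparr>)"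
    (is "coord_space _ (_\<lparr>carrier := ?C\<rparr>)")
proof -
  have "finite S" using assms finite_subset by blast
  then obtain h where h: "bij_betw h S {0..<card S}"
    using ex_bij_betw_finite_nat by blast
  then obtain g where g: "bij_betw g {0..<card S} S" "\<And>r. r \<in> S \<Longrightarrow> g (h r) = r"
      "\<And>j. j < card S \<Longrightarrow> h (g j) = j"
    by (metis bij_betw_inv_into bij_betw_inv_into_left bij_betw_inv_into_right atLeast0LessThan lessThan_iff)
  have h_less: "h r < card S" if "r \<in> S" for r
    using h that by (auto simp: bij_betw_def)
  have g_in: "g j \<in> S" "g j < n" if "j < card S" for j
    using g(1) that assms by (auto simp: bij_betw_def)
  interpret vec_space "TYPE(complex)" n .
  define T where "T u = vec n (\<lambda>r. if r \<in> S then u $ h r else (0 :: complex))" for u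
  show ?thesis
  proof (rule coord_spaceI[where T = T])
    have "VectorSpace.subspace class_ring ?C V"
      unfolding VectorSpace.subspace_def submodule_def submodule_axioms_def
      using vec_module vec_vs by auto
    then show "vectorspace class_ring (V\<lparr>carrier := ?C\<rparr>)"
      by (rule subspace_is_vs)
    show "bij_betw T (carrier_vec (card S)) (carrier (V\<lparr>carrier := ?C\<rparr>))"
    proof (rule bij_betw_byWitness[where f' = "\<lambda>v. vec (card S) (\<lambda>j. v $ g j)"])
      show "\<forall>a\<in>carrier_vec (card S). vec (card S) (\<lambda>j. T a $ g j) = a"
        using g g_in by (auto simp: T_def)
      show "\<forall>a\<in>carrier (V\<lparr>carrier := ?C\<rparr>). T (vec (card S) (\<lambda>j. a $ g j)) = a"
        using g h_less by (auto simp: T_def)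
    qed (use assms in \<open>auto simp: T_def\<close>)
  qed (use h_less in \<open>auto simp: T_def module_vec_simps\<close>)
qed

section \<open>Torus weights\<close>

text \<open>One weight for each standard basis vector, so multiplicities are recorded. The torus has
  to be diagonal in the given coordinates, not merely diagonalizable; \<open>sym_rep\<close> has
  this property, and \<open>sum_rep\<close> and \<open>tensor_rep\<close> preserve it.\<close>

definition torus_weights :: "rep \<Rightarrow> int list \<Rightarrow> bool" where
  "torus_weights E ws \<longleftrightarrow> length ws = rdim E \<and>
     (\<forall>z. cmod z = 1 \<longrightarrow> act E (torus z) = mat_diag (rdim E) (\<lambda>r. z powi (ws ! r)))"

text \<open>Distinct characters of the circle are separated by a point with
  \<open>z powi (a - b) = -1\<close>.\<close>

lemma ex_unit_powi_neq:
  assumes "a \<noteq> (b :: int)"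
  shows "\<exists>z. cmod z = 1 \<and> z powi a \<noteq> z powi b"
proof -
  define z where "z = cis (pi / of_int (a - b))"
  have "z powi (a - b) = cis (of_int (a - b) * (pi / of_int (a - b)))"
    unfolding z_def by (rule cis_power_int)
  then have "z powi (a - b) = -1" using assms by simp
  moreover have "z \<noteq> 0" by (simp add: z_def)
  ultimately have "z powi a \<noteq> z powi b" by (auto simp: power_int_diff)
  then show ?thesis by (intro exI[of _ z]) (simp add: z_def)
qed

text \<open>For a diagonal torus action, the weight space is the coordinate subspace on the
  positions \<open>S\<close> that carry the weight \<open>i\<close>.\<close>

lemma coord_space_weight_space:
  assumes "torus_weights E ws"
  shows "coord_space (count_list ws i) (weight_space E i)"
proof -
  define S where "S = {r. r < rdim E \<and> ws ! r = i}"
  have "card S = count_list ws i"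
    using assms unfolding count_list_eq_length_filter length_filter_conv_card S_def
    by (auto simp: torus_weights_def intro: arg_cong[where f = card])
  moreover have "(\<forall>z. cmod z = 1 \<longrightarrow> act E (torus z) *\<^sub>v v = z powi i \<cdot>\<^sub>v v) \<longleftrightarrow>
      (\<forall>r<rdim E. r \<notin> S \<longrightarrow> v $ r = 0)" (is "?L \<longleftrightarrow> ?R") if v: "v \<in> carrier_vec (rdim E)" for v
  proof -
    have entry: "(act E (torus z) *\<^sub>v v) $ r = z powi (ws ! r) * v $ r"
      if "cmod z = 1" "r < rdim E" for z r
    proof -
      have "(act E (torus z) *\<^sub>v v) $ r =
          (\<Sum>j = 0..<rdim E. (if r = j then z powi (ws ! j) else 0) * v $ j)"
        using assms that v
        by (auto simp: torus_weights_def mat_diag_def scalar_prod_def intro!: sum.cong)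
      also have "\<dots> = (\<Sum>j = 0..<rdim E. if r = j then z powi (ws ! j) * v $ j else 0)"
        by (intro sum.cong) auto
      finally show ?thesis using that by simp
    qed
    have dim: "dim_vec (act E (torus z) *\<^sub>v v) = rdim E" if "cmod z = 1" for z
      using assms that by (simp add: torus_weights_def mat_diag_def)
    show ?thesis
    proof
      assume L: ?L
      show ?R
      proof (intro allI impI)
        fix r assume r: "r < rdim E" "r \<notin> S"
        \<comment> \<open>One point where the characters of weights \<open>ws ! r\<close> and
          \<open>i\<close> differ is enough to kill the entry at \<open>r\<close>.\<close>
        then obtain z where z: "cmod z = 1" "z powi (ws ! r) \<noteq> z powi i"
          using ex_unit_powi_neq[of "ws ! r" i] by (auto simp: S_def)
        have "z powi (ws ! r) * v $ r = z powi i * v $ r"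
          using entry[OF z(1) r(1)] L z r v by simp
        then show "v $ r = 0" using z(2) by simp
      qed
    next
      assume R: ?R
      show ?L
      proof (intro allI impI eq_vecI)
        fix z :: complex and r
        assume "cmod z = 1" "r < dim_vec (z powi i \<cdot>\<^sub>v v)"
        then show "(act E (torus z) *\<^sub>v v) $ r = (z powi i \<cdot>\<^sub>v v) $ r"
          using entry[of z r] R v by (cases "r \<in> S") (auto simp: S_def)
      qed (use dim v in auto)
    qed
  qed
  then have "weight_space E i = (module_vec TYPE(complex) (rdim E))
      \<lparr>carrier := {v \<in> carrier_vec (rdim E). \<forall>r<rdim E. r \<notin> S \<longrightarrow> v $ r = 0}\<rparr>"
    unfolding weight_space_def
    by (intro arg_cong[where f = "\<lambda>C. module_vec TYPE(complex) (rdim E) \<lparr>carrier := C\<rparr>"]) blast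
  ultimately show ?thesis
    using coord_space_vanishing[of S "rdim E"] by (auto simp: S_def)
qed

text \<open>The monomial \<open>x^(k-p) y^p\<close> has weight \<open>(k - p) - p\<close>.\<close>

definition sym_weights :: "nat \<Rightarrow> int list" where
  "sym_weights k = map (\<lambda>p. int k - 2 * int p) [0..<k + 1]"

lemma torus_weights_sym_rep: "torus_weights (sym_rep k) (sym_weights k)"
  unfolding torus_weights_def
proof (intro conjI allI impI)
  fix z :: complex
  assume "cmod z = 1"
  then have z: "z \<noteq> 0" by auto
  show "act (sym_rep k) (torus z) =
      mat_diag (rdim (sym_rep k)) (\<lambda>r. z powi (sym_weights k ! r))"
  proof (rule eq_matI)
    fix r s
    assume "r < dim_row (mat_diag (rdim (sym_rep k)) (\<lambda>r. z powi (sym_weights k ! r)))"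
      "s < dim_col (mat_diag (rdim (sym_rep k)) (\<lambda>r. z powi (sym_weights k ! r)))"
    then have rs: "r < k + 1" "s < k + 1" by (auto simp: sym_rep_def mat_diag_def)
    \<comment> \<open>This polynomial holds column \<open>s\<close> of the action. It is a single
      monomial of degree \<open>s\<close>, so only the diagonal entry survives.\<close>
    have "[:z:] ^ (k - s) * [:0, inverse z:] ^ s = monom (z ^ (k - s) * inverse z ^ s) s"
    proof -
      have "[:z:] = monom z 0" "[:0, inverse z:] = monom (inverse z) 1"
        by (simp_all add: monom_0 monom_Suc)
      then show ?thesis by (simp only: monom_power mult_monom) simp
    qed
    moreover have "z ^ (k - s) * inverse z ^ s = z powi (int k - 2 * int s)"
    proof -
      have "int k - 2 * int s = int (k - s) - int s" using rs by simp
      then have "z powi (int k - 2 * int s) = z ^ (k - s) / z ^ s"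
        using z power_int_diff[of z "int (k - s)" "int s"] by (simp only: power_int_of_nat simp_thms)
      then show ?thesis by (simp only: divide_inverse power_inverse)
    qed
    ultimately show "act (sym_rep k) (torus z) $$ (r, s) =
        mat_diag (rdim (sym_rep k)) (\<lambda>r. z powi (sym_weights k ! r)) $$ (r, s)"
      using rs by (auto simp: sym_rep_def torus_def sym_weights_def mat_diag_def
          simp del: upt_Suc)
  qed (auto simp: sym_rep_def mat_diag_def)
qed (simp add: sym_weights_def sym_rep_def)

lemma torus_weights_sum_rep:
  assumes "list_all2 torus_weights Es wss"
  shows "torus_weights (sum_rep Es) (concat wss)"
  using assms
proof (induction rule: list_all2_induct)
  case Nil
  show ?case by (auto simp: torus_weights_def sum_rep_def mat_diag_def intro!: eq_matI)
next
  case (Cons E Es ws wss)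
  have len: "length ws = rdim E" "length (concat wss) = rdim (sum_rep Es)"
    using Cons by (auto simp: torus_weights_def)
  have dim: "rdim (sum_rep (E # Es)) = rdim E + rdim (sum_rep Es)"
    by (simp add: sum_rep_def)
  have "act (sum_rep (E # Es)) (torus z) =
      mat_diag (rdim E + rdim (sum_rep Es)) (\<lambda>r. z powi ((ws @ concat wss) ! r))"
    if z: "cmod z = 1" for z
  proof -
    have E: "act E (torus z) = mat_diag (rdim E) (\<lambda>r. z powi (ws ! r))"
      and Es: "diag_block_mat (map (\<lambda>E. act E (torus z)) Es) =
        mat_diag (rdim (sum_rep Es)) (\<lambda>r. z powi (concat wss ! r))"
      using Cons z by (auto simp: torus_weights_def sum_rep_def)
    have act: "act (sum_rep (E # Es)) (torus z) = diag_block_mat (act E (torus z) # map (\<lambda>E. act E (torus z)) Es)"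
      by (simp add: sum_rep_def)
    show ?thesis
      unfolding act
      by (rule eq_matI) (auto simp: Let_def E Es mat_diag_def nth_append len)
  qed
  then show ?case using len dim by (simp add: torus_weights_def)
qed

text \<open>\<open>List.product\<close> lets the second component run fastest, which is the
  Kronecker order of \<open>tensor_rep\<close>: position \<open>r\<close> belongs to the pair
  \<open>(r div rdim F, r mod rdim F)\<close>. The characters multiply, so the weights add.\<close>

lemma torus_weights_tensor_rep:
  assumes "torus_weights E ws" "torus_weights F us"
  shows "torus_weights (tensor_rep E F) (map (\<lambda>(a, b). a + b) (List.product ws us))"
proof -
  have len: "length ws = rdim E" "length us = rdim F"
    using assms by (auto simp: torus_weights_def)
  have "act (tensor_rep E F) (torus z) = mat_diag (rdim E * rdim F)
      (\<lambda>r. z powi (map (\<lambda>(a, b). a + b) (List.product ws us) ! r))" if z: "cmod z = 1" for z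
  proof (rule eq_matI)
    fix r s
    assume "r < dim_row (mat_diag (rdim E * rdim F)
        (\<lambda>r. z powi (map (\<lambda>(a, b). a + b) (List.product ws us) ! r)))"
      "s < dim_col (mat_diag (rdim E * rdim F)
        (\<lambda>r. z powi (map (\<lambda>(a, b). a + b) (List.product ws us) ! r)))"
    then have rs: "r < rdim E * rdim F" "s < rdim E * rdim F" by (auto simp: mat_diag_def)
    then have pos: "rdim F > 0" by (auto intro: gr0I)
    have eq: "r = s \<longleftrightarrow> r div rdim F = s div rdim F \<and> r mod rdim F = s mod rdim F"
      by (metis div_mult_mod_eq)
    have "z \<noteq> 0" using z by auto
    moreover have "r div rdim F < rdim E" "s div rdim F < rdim E"
      using rs by (auto simp: less_mult_imp_div_less)
    ultimately show "act (tensor_rep E F) (torus z) $$ (r, s) = mat_diag (rdim E * rdim F)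
        (\<lambda>r. z powi (map (\<lambda>(a, b). a + b) (List.product ws us) ! r)) $$ (r, s)"
      using rs pos assms z eq
      by (auto simp: tensor_rep_def torus_weights_def mat_diag_def product_nth power_int_add)
  qed (auto simp: tensor_rep_def mat_diag_def)
  then show ?thesis using len by (simp add: torus_weights_def tensor_rep_def)
qed

section \<open>Weight multiplicities\<close>

lemma count_list_concat: "count_list (concat xss) x = (\<Sum>xs\<leftarrow>xss. count_list xs x)"
  by (induction xss) auto

text \<open>The weight multiplicities of a tensor product are a convolution: a first weight
  \<open>a\<close> leaves \<open>i - a\<close> for the second.\<close>

lemma count_list_sums:
  fixes ws us :: "int list"
  shows "count_list (map (\<lambda>(a, b). a + b) (List.product ws us)) i = (\<Sum>a\<leftarrow>ws. count_list us (i - a))"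
proof (induction ws)
  case (Cons a ws)
  have "count_list (map (\<lambda>b. a + b) us) i = count_list us (i - a)"
    by (induction us) auto
  then show ?case using Cons by (simp add: comp_def)
qed simp

text \<open>This convolution is the dimension of the weight space \<open>i\<close> of Sym^k
  \<otimes> Sym^l.\<close>

definition sym_mult :: "nat \<Rightarrow> nat \<Rightarrow> int \<Rightarrow> nat" where
  "sym_mult k l i = (\<Sum>a\<leftarrow>sym_weights k. count_list (sym_weights l) (i - a))"

lemma sum_list_concat: "(\<Sum>x\<leftarrow>concat xss. f x) = (\<Sum>xs\<leftarrow>xss. \<Sum>x\<leftarrow>xs. f x :: nat)"
  by (induction xss) auto

text \<open>The tensor product is distributed over the direct sums at the level of weight counts
  only, so no isomorphism of representations is needed. The lists \<open>ks\<close> and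
  \<open>ls\<close> repeat a highest weight according to its multiplicity.\<close>

lemma coord_space_tensor_sum_sym:
  "coord_space (\<Sum>k\<leftarrow>ks. \<Sum>l\<leftarrow>ls. sym_mult k l i)
    (weight_space (tensor_rep (sum_rep (map sym_rep ks)) (sum_rep (map sym_rep ls))) i)"
proof -
  have sum: "torus_weights (sum_rep (map sym_rep ks)) (concat (map sym_weights ks))" for ks
    by (rule torus_weights_sum_rep) (simp add: list_all2_conv_all_nth torus_weights_sym_rep)
  have swap: "(\<Sum>a\<leftarrow>ws. \<Sum>l\<leftarrow>ls. f a l) = (\<Sum>l\<leftarrow>ls. \<Sum>a\<leftarrow>ws. f a l)"
    for ws ls and f :: "int \<Rightarrow> nat \<Rightarrow> nat"
    by (induction ws) (auto simp: sum_list_addf)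
  have "count_list (map (\<lambda>(a, b). a + b)
      (List.product (concat (map sym_weights ks)) (concat (map sym_weights ls)))) i =
    (\<Sum>k\<leftarrow>ks. \<Sum>l\<leftarrow>ls. sym_mult k l i)"
    unfolding count_list_sums sum_list_concat count_list_concat sym_mult_def
    by (simp add: swap comp_def)
  then show ?thesis
    using coord_space_weight_space[OF torus_weights_tensor_rep[OF sum[of ks] sum[of ls]], of i]
    by simp
qed

text \<open>All weights of Sym^l are simple, so the convolution counts the \<open>p\<close> that
  have a partner \<open>q\<close> with \<open>(k - 2p) + (l - 2q) = i\<close>.\<close>

lemma sym_mult_eq_card:
  "sym_mult k l i = card {p. p \<le> k \<and> (\<exists>q\<le>l. int k + int l - i = 2 * int p + 2 * int q)}"
proof -
  have one: "count_list (sym_weights l) j = of_bool (\<exists>q\<le>l. int l - 2 * int q = j)" for j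
  proof -
    have "count_list xs j = of_bool (j \<in> set xs)" if "distinct xs" for xs
      using that by (induction xs) auto
    moreover have "distinct (sym_weights l)"
      by (auto simp: sym_weights_def distinct_map inj_on_def)
    ultimately have "count_list (sym_weights l) j = of_bool (j \<in> set (sym_weights l))"
      by simp
    then show ?thesis
      by (auto simp: sym_weights_def image_iff less_Suc_eq_le simp del: upt_Suc)
  qed
  have "sym_mult k l i = (\<Sum>p\<le>k. of_bool (\<exists>q\<le>l. int l - 2 * int q = i - (int k - 2 * int p)))"
    unfolding sym_mult_def one
    by (simp add: sym_weights_def comp_def interv_sum_list_conv_sum_set_nat atLeast0LessThan lessThan_Suc_atMost
        del: upt_Suc)
  also have "\<dots> = card {p \<in> {..k}. \<exists>q\<le>l. int l - 2 * int q = i - (int k - 2 * int p)}"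
    by (simp add: sum_of_bool_eq Int_def)
  also have "\<dots> = card {p. p \<le> k \<and> (\<exists>q\<le>l. int k + int l - i = 2 * int p + 2 * int q)}"
    by (intro arg_cong[where f = card] Collect_cong) (auto simp: algebra_simps)
  finally show ?thesis .
qed

text \<open>The sum \<open>p + q\<close> is fixed, so the admissible \<open>p\<close> form an
  interval; its length is dictated by the smaller of the two factors.\<close>

lemma sym_mult_1:
  assumes "odd (k + l)"
  shows "sym_mult k l 1 = min k l + 1"
proof -
  have "(\<exists>e. l = k + 1 + 2 * e) \<or> (\<exists>e. k = l + 1 + 2 * e)"
    using assms by presburger
  then consider e where "l = k + 1 + 2 * e" | e where "k = l + 1 + 2 * e"
    by blast
  then show ?thesis
  proof cases
    case 1
    have "{p. p \<le> k \<and> (\<exists>q\<le>l. int k + int l - 1 = 2 * int p + 2 * int q)} = {..k}"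
      by (auto simp: 1; presburger)
    then show ?thesis using 1 by (simp add: sym_mult_eq_card)
  next
    case 2
    \<comment> \<open>Here \<open>p + q = l + e\<close>, and the condition that \<open>q\<close>
      lies between 0 and \<open>l\<close> says exactly that \<open>p\<close> lies between
      \<open>e\<close> and \<open>e + l\<close>.\<close>
    have "{p. p \<le> k \<and> (\<exists>q\<le>l. int k + int l - 1 = 2 * int p + 2 * int q)} = {e..e + l}"
      by (auto simp: 2; presburger)
    then show ?thesis using 2 by (simp add: sym_mult_eq_card)
  qed
qed

text \<open>In Clebsch-Gordan terms, each of the \<open>min k l + 1\<close> irreducible constituents
  has weight 2 once, except the trivial one, which occurs exactly if \<open>k = l\<close>. The proof
  counts pairs directly.\<close>

lemma sym_mult_2:
  assumes "even (k + l)"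
  shows "sym_mult k l 2 + of_bool (k = l) = min k l + 1"
proof -
  have "k = l \<or> (\<exists>e. l = k + 2 + 2 * e) \<or> (\<exists>e. k = l + 2 + 2 * e)"
    using assms by presburger
  then consider "k = l" | e where "l = k + 2 + 2 * e" | e where "k = l + 2 + 2 * e"
    by blast
  then show ?thesis
  proof cases
    case 1
    \<comment> \<open>Here \<open>p + q = k - 1\<close> over the integers, which leaves no partner
      for \<open>p = k\<close>. For \<open>k = 0\<close> both sets are empty.\<close>
    have "{p. p \<le> k \<and> (\<exists>q\<le>l. int k + int l - 2 = 2 * int p + 2 * int q)} = {..<k}"
      by (auto simp: 1; presburger)
    then show ?thesis using 1 by (simp add: sym_mult_eq_card)
  next
    case 2
    have "{p. p \<le> k \<and> (\<exists>q\<le>l. int k + int l - 2 = 2 * int p + 2 * int q)} = {..k}"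
      by (auto simp: 2; presburger)
    then show ?thesis using 2 by (simp add: sym_mult_eq_card)
  next
    case 3
    have "{p. p \<le> k \<and> (\<exists>q\<le>l. int k + int l - 2 = 2 * int p + 2 * int q)} = {e..e + l}"
      by (auto simp: 3; presburger)
    then show ?thesis using 3 by (simp add: sym_mult_eq_card)
  qed
qed

lemma sum_list_concat_replicate:
  fixes f :: "nat \<Rightarrow> nat"
  shows "(\<Sum>k\<leftarrow>concat (map (\<lambda>i. replicate (n i) (g i)) [a..<b]). f k) = (\<Sum>i = a..<b. n i * f (g i))"
  by (simp add: sum_list_concat comp_def sum_list_replicate interv_sum_list_conv_sum_set_nat)

section \<open>The quadratic form\<close>

text \<open>The two families of indices are kept separate so that the mixed form and both pure forms
  are instances.\<close>

lemma sum_min_form: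
  fixes f g :: "nat \<Rightarrow> int" and \<alpha> \<beta> :: "nat \<Rightarrow> nat"
  assumes "\<And>s. s \<in> S \<Longrightarrow> \<alpha> s \<le> D"
  shows "(\<Sum>s\<in>S. \<Sum>t\<in>T. f s * g t * (int (min (\<alpha> s) (\<beta> t)) + 1)) =
    (\<Sum>j\<le>D. (\<Sum>s\<in>S. f s * of_bool (j \<le> \<alpha> s)) * (\<Sum>t\<in>T. g t * of_bool (j \<le> \<beta> t)))"
proof -
  have min: "int (min (\<alpha> s) b) + 1 = (\<Sum>j\<le>D. of_bool (j \<le> \<alpha> s) * of_bool (j \<le> b))"
    if "s \<in> S" for s b
  proof -
    \<comment> \<open>The minimum is at most \<open>\<alpha> s\<close>, so a bound on
      \<open>\<alpha>\<close> alone ensures that stopping at \<open>D\<close> loses no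
      \<open>j\<close>.\<close>
    have "{..D} \<inter> {j. j \<le> \<alpha> s \<and> j \<le> b} = {..min (\<alpha> s) b}"
      using assms[OF that] by auto
    then show ?thesis by (simp add: of_bool_conj[symmetric] sum_of_bool_eq)
  qed
  have "(\<Sum>s\<in>S. \<Sum>t\<in>T. f s * g t * (int (min (\<alpha> s) (\<beta> t)) + 1)) =
    (\<Sum>s\<in>S. \<Sum>t\<in>T. \<Sum>j\<le>D. (f s * of_bool (j \<le> \<alpha> s)) * (g t * of_bool (j \<le> \<beta> t)))"
    by (intro sum.cong refl) (simp only: min sum_distrib_left mult_ac)
  also have "\<dots> = (\<Sum>s\<in>S. \<Sum>j\<le>D. \<Sum>t\<in>T. (f s * of_bool (j \<le> \<alpha> s)) * (g t * of_bool (j \<le> \<beta> t)))"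
    by (intro sum.cong refl sum.swap)
  also have "\<dots> = (\<Sum>j\<le>D. \<Sum>s\<in>S. \<Sum>t\<in>T. (f s * of_bool (j \<le> \<alpha> s)) * (g t * of_bool (j \<le> \<beta> t)))"
    by (rule sum.swap)
  finally show ?thesis by (simp only: sum_product)
qed

text \<open>Injectivity of \<open>\<alpha>\<close> turns the exception
  \<open>\<alpha> s = \<alpha> t\<close> into \<open>s = t\<close>, so the corrections collapse from
  a double sum to the sum of squares.\<close>

lemma sum_sym_mult_2:
  fixes f \<alpha> :: "nat \<Rightarrow> nat"
  assumes "finite S" "inj_on \<alpha> S" "\<And>s t. s \<in> S \<Longrightarrow> t \<in> S \<Longrightarrow> even (\<alpha> s + \<alpha> t)"
  shows "int (\<Sum>s\<in>S. f s * (\<Sum>t\<in>S. f t * sym_mult (\<alpha> s) (\<alpha> t) 2)) + int (\<Sum>s\<in>S. (f s)\<^sup>2) =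
    (\<Sum>s\<in>S. \<Sum>t\<in>S. int (f s) * int (f t) * (int (min (\<alpha> s) (\<alpha> t)) + 1))"
proof -
  have "int (min (\<alpha> s) (\<alpha> t)) + 1 = int (sym_mult (\<alpha> s) (\<alpha> t) 2) + of_bool (s = t)"
    if "s \<in> S" "t \<in> S" for s t
  proof -
    have "\<alpha> s = \<alpha> t \<longleftrightarrow> s = t" using assms(2) that by (rule inj_on_eq_iff)
    then have "sym_mult (\<alpha> s) (\<alpha> t) 2 + of_bool (s = t) = min (\<alpha> s) (\<alpha> t) + 1"
      using sym_mult_2[OF assms(3)[OF that]] by simp
    from arg_cong[OF this, of int] show ?thesis by simp
  qed
  then have "(\<Sum>s\<in>S. \<Sum>t\<in>S. int (f s) * int (f t) * (int (min (\<alpha> s) (\<alpha> t)) + 1)) =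
      (\<Sum>s\<in>S. \<Sum>t\<in>S. int (f s) * int (f t) * int (sym_mult (\<alpha> s) (\<alpha> t) 2)
        + (if s = t then int (f s) * int (f t) else 0))"
    by (intro sum.cong refl) (auto simp: algebra_simps)
  also have "\<dots> = (\<Sum>s\<in>S. \<Sum>t\<in>S. int (f s) * int (f t) * int (sym_mult (\<alpha> s) (\<alpha> t) 2))
      + (\<Sum>s\<in>S. int (f s) * int (f s))"
    using assms(1) by (simp add: sum.distrib)
  finally show ?thesis
    by (simp add: sum_distrib_left power2_eq_square mult.assoc)
qed

theorem corollary1:
  fixes d :: nat and n m :: "nat \<Rightarrow> nat" and V W :: rep
  assumes "V = sum_rep (concat (map (\<lambda>i. replicate (n i) (sym_rep (2 * i))) [0..<d + 1]))"
    and "W = sum_rep (concat (map (\<lambda>i. replicate (m i) (sym_rep (2 * i - 1))) [1..<d + 1]))"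
  shows "2 * int (cdim (weight_space (tensor_rep V W) 1))
      - int (cdim (direct_sum (weight_space (tensor_rep V V) 2) (weight_space (tensor_rep W W) 2)))
    \<le> int ((\<Sum>i = 0..d. (n i)\<^sup>2) + (\<Sum>i = 1..d. (m i)\<^sup>2))"
proof -
  let ?A = "{0..<d + 1}" and ?B = "{1..<d + 1}"
  \<comment> \<open>The highest weights in \<open>V\<close> and \<open>W\<close>. The truncated
    subtraction in \<open>\<beta>\<close> does no harm because the indices in \<open>?B\<close>
    start at 1.\<close>
  define \<alpha> \<beta> :: "nat \<Rightarrow> nat" where "\<alpha> s = 2 * s" and "\<beta> t = 2 * t - 1" for s t
  define ks where "ks = concat (map (\<lambda>i. replicate (n i) (\<alpha> i)) [0..<d + 1])"
  define ls where "ls = concat (map (\<lambda>i. replicate (m i) (\<beta> i)) [1..<d + 1])"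
  have V: "V = sum_rep (map sym_rep ks)" and W: "W = sum_rep (map sym_rep ls)"
    by (simp_all add: assms ks_def ls_def \<alpha>_def \<beta>_def map_concat comp_def del: upt_Suc)
  define VW VV WW where
    "VW = (\<Sum>k\<leftarrow>ks. \<Sum>l\<leftarrow>ls. sym_mult k l 1)" and
    "VV = (\<Sum>k\<leftarrow>ks. \<Sum>l\<leftarrow>ks. sym_mult k l 2)" and
    "WW = (\<Sum>k\<leftarrow>ls. \<Sum>l\<leftarrow>ls. sym_mult k l 2)"
  have dims: "cdim (weight_space (tensor_rep V W) 1) = VW"
    "cdim (direct_sum (weight_space (tensor_rep V V) 2) (weight_space (tensor_rep W W) 2)) = VV + WW"
    unfolding V W VW_def VV_def WW_def
    by (intro cdim_coord_space coord_space_direct_sum coord_space_tensor_sum_sym)+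
  \<comment> \<open>\<open>X j\<close> and \<open>Y j\<close> count the irreducible summands of
    \<open>V\<close> and \<open>W\<close> with highest weight at least \<open>j\<close>.\<close>
  define X where "X j = (\<Sum>s\<in>?A. int (n s) * of_bool (j \<le> \<alpha> s))" for j
  define Y where "Y j = (\<Sum>t\<in>?B. int (m t) * of_bool (j \<le> \<beta> t))" for j
  have \<alpha>: "\<alpha> s \<le> 2 * d" if "s \<in> ?A" for s using that by (simp add: \<alpha>_def)
  have \<beta>: "\<beta> t \<le> 2 * d" if "t \<in> ?B" for t using that by (auto simp: \<beta>_def)
  have "int VW = (\<Sum>s\<in>?A. \<Sum>t\<in>?B. int (n s) * int (m t) * (int (min (\<alpha> s) (\<beta> t)) + 1))"
  proof -
    \<comment> \<open>For \<open>t\<close> in \<open>?B\<close> the number \<open>\<beta> t\<close>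
      is odd while \<open>\<alpha> s\<close> is even, as \<open>sym_mult_1\<close> requires.\<close>
    have "int (sym_mult (\<alpha> s) (\<beta> t) 1) = int (min (\<alpha> s) (\<beta> t)) + 1" if "t \<in> ?B" for s t
      using that sym_mult_1[of "\<alpha> s" "\<beta> t"] by (auto simp: \<alpha>_def \<beta>_def)
    then have "(\<Sum>s\<in>?A. \<Sum>t\<in>?B. int (n s) * int (m t) * (int (min (\<alpha> s) (\<beta> t)) + 1)) =
        (\<Sum>s\<in>?A. \<Sum>t\<in>?B. int (n s) * int (m t) * int (sym_mult (\<alpha> s) (\<beta> t) 1))"
      by (intro sum.cong refl) simp
    then show ?thesis
      unfolding VW_def ks_def ls_def sum_list_concat_replicate
      by (simp add: sum_distrib_left mult.assoc del: sum.op_ivl_Suc)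
  qed
  also have "\<dots> = (\<Sum>j\<le>2 * d. X j * Y j)"
    unfolding X_def Y_def by (intro sum_min_form \<alpha>)
  finally have VW: "int VW = (\<Sum>j\<le>2 * d. X j * Y j)" .
  have "int VV + int (\<Sum>s\<in>?A. (n s)\<^sup>2) =
      (\<Sum>s\<in>?A. \<Sum>t\<in>?A. int (n s) * int (n t) * (int (min (\<alpha> s) (\<alpha> t)) + 1))"
    unfolding VV_def ks_def sum_list_concat_replicate
    by (intro sum_sym_mult_2) (auto simp: \<alpha>_def inj_on_def)
  also have "\<dots> = (\<Sum>j\<le>2 * d. X j * X j)"
    unfolding X_def by (intro sum_min_form \<alpha>)
  finally have VV: "int VV + int (\<Sum>s\<in>?A. (n s)\<^sup>2) = (\<Sum>j\<le>2 * d. X j * X j)" .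
  \<comment> \<open>On \<open>?B\<close> the map \<open>\<beta>\<close> is injective with odd
    values, so sums of two values are even.\<close>
  have "int WW + int (\<Sum>s\<in>?B. (m s)\<^sup>2) =
      (\<Sum>s\<in>?B. \<Sum>t\<in>?B. int (m s) * int (m t) * (int (min (\<beta> s) (\<beta> t)) + 1))"
    unfolding WW_def ls_def sum_list_concat_replicate
    by (intro sum_sym_mult_2) (auto simp: \<beta>_def inj_on_def)
  also have "\<dots> = (\<Sum>j\<le>2 * d. Y j * Y j)"
    unfolding Y_def by (intro sum_min_form \<beta>)
  finally have WW: "int WW + int (\<Sum>s\<in>?B. (m s)\<^sup>2) = (\<Sum>j\<le>2 * d. Y j * Y j)" .
  \<comment> \<open>The alternating sign of the multiplicities appears as the difference
    \<open>X j - Y j\<close>: even highest weights count positively, odd ones negatively.\<close>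
  have "0 \<le> (\<Sum>j\<le>2 * d. (X j - Y j)\<^sup>2)" by (intro sum_nonneg) simp
  also have "\<dots> = (\<Sum>j\<le>2 * d. X j * X j) + (\<Sum>j\<le>2 * d. Y j * Y j) - 2 * (\<Sum>j\<le>2 * d. X j * Y j)"
    by (simp add: power2_eq_square algebra_simps sum.distrib sum_subtractf sum_distrib_left
        del: sum.atMost_Suc)
  finally have "2 * int VW - int (VV + WW) \<le> int ((\<Sum>s\<in>?A. (n s)\<^sup>2) + (\<Sum>s\<in>?B. (m s)\<^sup>2))"
    using VW VV WW by simp
  then show ?thesis
    unfolding dims by (simp only: Suc_eq_plus1[symmetric] atLeastLessThanSuc_atLeastAtMost)
qed

end
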